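(* As operators acting on $\mathbf{P}$, $$\sum_{n=1}^\infty\frac1{n!}L_n^Z=\exp\Big\{\int_0^1\dot Z(t)\,dW(t)-\frac12\int_0^1\dot Z(t)^2\,dt\Big\}\,\big(1-\widetilde{e}^{D_{-Z}}\big).$$
   Context: $(\mathscr{W},\mathscr{B}(\mathscr{W}),\gamma)$ is the Wiener space: $\mathscr{W}$ is the set of continuous paths $w:[0,1]\to\mathbb{R}$ with $w(0)=0$, with the $\sigma$-field generated by the topology of uniform convergence, and $\gamma$ is Wiener measure; $W(t,w)=w(t)$ is the canonical Wiener process. $\mathscr{H}\subset\mathscr{W}$ is the Cameron-Martin space of absolutely continuous $h$ with square-integrable derivative $\dot h$, with inner product $\langle h_1,h_2\rangle=\int_0^1\dot h_1(t)\dot h_2(t)\,dt$. For $h\in\mathscr{H}$, $[h](w):=\int_0^1\dot h(t)\,dw(t)$ (Wiener integral), with the convention $[h](w+\theta)=[h](w)+\langle h,\theta\rangle$ for $\theta\in\mathscr{H}$. $\mathbf{P}$ is the algebra of polynomial functionals $F(w)=p([h_1](w),\dots,[h_n](w))$, with $n\in\mathbb{N}$, $h_i\in\mathscr{H}$, $p$ a real polynomial in $n$ variables. For $\theta\in\mathscr{H}$, $D_\theta F(w)=\lim_{\varepsilon\to0}\frac1\varepsilon\{F(w+\varepsilon\theta)-F(w)\}$. Standing assumptions on $Z$: $Z:\mathscr{W}\to\mathscr{H}$ is a predictable map, i.e. $\dot Z(t)$, $0\le t\le1$, is a predictable process with $\|Z\|_{\mathscr{H}}^2=\int_0^1\dot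 Z(s)^2ds<\infty$ a.s., and the process $\exp\{\int_0^t\dot Z(s)\,dW(s)-\frac12\int_0^t\dot Z(s)^2ds\}$ is a true martingale. Fix a complete orthonormal system $\{e_i\}_{i\in\mathbb{N}}$ of $\mathscr{H}$ and write $D_i=D_{e_i}$. For an $\mathscr{H}$-valued $Y$ on $\mathscr{W}$ put $Y_i=\langle Y,e_i\rangle$, $D_Y^{\otimes n}F:=\sum_{i_1,\dots,i_n}Y_{i_1}\cdots Y_{i_n}D_{i_1}\cdots D_{i_n}F$ for $F\in\mathbf{P}$ ($D_Y^{\otimes0}=1$), and $\widetilde{e}^{D_Y}:=\sum_{n=0}^\infty\frac1{n!}D_Y^{\otimes n}$. The polynomials $\hat H_n(x,y)$ are defined by $e^{\lambda x-\frac{\lambda^2}{2}y}=\sum_{n=0}^\infty\frac{\lambda^n}{n!}\hat H_n(x,y)$. The operators $L_n^Z$ on $\mathbf{P}$ are defined by $L_0^Z=\mathrm{id}$ and, for $n\ge1$, $$L_n^Z=-\sum_{k=1}^n\binom nk\hat H_{n-k}\Big(\int_0^1\dot Z(s)\,dW(s),\ \|Z\|_{\mathscr{H}}^2\Big)D_{-Z}^{\otimes k}.$$ *)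

theory Defs
  imports
    "HOL-Probability.Probability"
    "HOL-Library.Poly_Mapping"
begin

section \<open>Wiener space\<close>

text \<open>A path on \<open>[0,1]\<close> is encoded as a function on the real line that vanishes outside
  \<open>[0,1]\<close>; paths are then determined by their values on \<open>[0,1]\<close>, and the set is closed under
  pointwise linear operations.\<close>

type_synonym wpath = "real \<Rightarrow> real"

definition wiener_paths :: "wpath set" where
  "wiener_paths = {w. continuous_on {0..1} w \<and> w 0 = 0 \<and> (\<forall>t. t \<notin> {0..1} \<longrightarrow> w t = 0)}"

definition uniform_open :: "wpath set \<Rightarrow> bool" where
  "uniform_open U \<longleftrightarrow> U \<subseteq> wiener_paths \<and>
     (\<forall>w\<in>U. \<exists>\<epsilon>>0. \<forall>v\<in>wiener_paths. (\<forall>t\<in>{0..1}. \<bar>v t - w t\<bar> < \<epsilon>) \<longrightarrow> v \<in> U)"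

definition wiener_sigma :: "wpath measure" where
  "wiener_sigma = sigma wiener_paths {U. uniform_open U}"

definition wiener_measure :: "wpath measure \<Rightarrow> bool" where
  "wiener_measure \<gamma> \<longleftrightarrow>
     sets \<gamma> = sets wiener_sigma \<and> prob_space \<gamma> \<and>
     (\<forall>s t. 0 \<le> s \<and> s < t \<and> t \<le> 1 \<longrightarrow>
        distributed \<gamma> lborel (\<lambda>w. w t - w s) (normal_density 0 (sqrt (t - s)))) \<and>
     (\<forall>n (\<tau> :: nat \<Rightarrow> real). (\<forall>i\<le>n. \<tau> i \<in> {0..1}) \<and> (\<forall>i<n. \<tau> i < \<tau> (Suc i)) \<longrightarrow>
        prob_space.indep_vars \<gamma> (\<lambda>_. borel) (\<lambda>i w. w (\<tau> (Suc i)) - w (\<tau> i)) {..<n})"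


section \<open>Cameron--Martin space\<close>

definition absolutely_continuous_fun :: "real set \<Rightarrow> (real \<Rightarrow> real) \<Rightarrow> bool" where
  "absolutely_continuous_fun S f \<longleftrightarrow>
     (\<forall>\<epsilon>>0. \<exists>\<delta>>0. \<forall>(n::nat) a b.
        (\<forall>i<n. a i \<le> b i \<and> {a i..b i} \<subseteq> S) \<and>
        disjoint_family_on (\<lambda>i. {a i<..<b i}) {..<n} \<and>
        (\<Sum>i<n. b i - a i) < \<delta>
        \<longrightarrow> (\<Sum>i<n. \<bar>f (b i) - f (a i)\<bar>) < \<epsilon>)"

definition square_integrable01 :: "(real \<Rightarrow> real) \<Rightarrow> bool" where
  "square_integrable01 g \<longleftrightarrow>
     set_borel_measurable lborel {0..1} g \<and> set_integrable lborel {0..1} (\<lambda>t. (g t)\<^sup>2)"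

text \<open>Almost everywhere differentiability is automatic for absolutely continuous functions (Lebesgue),
  and so is the measurability of \<open>deriv h\<close>; both are spelled out because these facts are not in
  the library. On the null set where \<open>h\<close> is not differentiable, \<open>deriv h\<close> is an arbitrary
  constant, which does not influence any integral.\<close>

definition cameron_martin :: "wpath set" where
  "cameron_martin = {h \<in> wiener_paths. absolutely_continuous_fun {0..1} h \<and>
     (AE t in lborel. t \<in> {0..1} \<longrightarrow> h differentiable at t) \<and> square_integrable01 (deriv h)}"

definition cm_inner :: "wpath \<Rightarrow> wpath \<Rightarrow> real" where
  "cm_inner h k = (LBINT t:{0..1}. deriv h t * deriv k t)"

definition complete_orthonormal_system :: "(nat \<Rightarrow> wpath) \<Rightarrow> bool" where
  "complete_orthonormal_system e \<longleftrightarrow>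
     (\<forall>i. e i \<in> cameron_martin) \<and>
     (\<forall>i j. cm_inner (e i) (e j) = (if i = j then 1 else 0)) \<and>
     (\<forall>h\<in>cameron_martin. (\<forall>i. cm_inner h (e i) = 0) \<longrightarrow> h = (\<lambda>_. 0))"


section \<open>Filtration, predictability, stochastic integrals\<close>

text \<open>The filtration is the canonical one, augmented by the \<open>\<gamma>\<close>-null sets.\<close>

definition wiener_filtration :: "wpath measure \<Rightarrow> real \<Rightarrow> wpath measure" where
  "wiener_filtration \<gamma> t = sigma wiener_paths
     ({(\<lambda>w. w s) -` B \<inter> wiener_paths | s B. s \<in> {0..t} \<and> B \<in> sets borel}
        \<union> null_sets (completion \<gamma>))"

definition predictable_sigma :: "wpath measure \<Rightarrow> (real \<times> wpath) measure" where
  "predictable_sigma \<gamma> = sigma ({0..1} \<times> wiener_paths)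
     ({{0} \<times> A | A. A \<in> sets (wiener_filtration \<gamma> 0)} \<union>
      {{s<..t} \<times> A | s t A. 0 \<le> s \<and> s \<le> t \<and> t \<le> 1 \<and> A \<in> sets (wiener_filtration \<gamma> s)})"

definition predictable_process :: "wpath measure \<Rightarrow> (real \<Rightarrow> wpath \<Rightarrow> real) \<Rightarrow> bool" where
  "predictable_process \<gamma> \<Phi> \<longleftrightarrow> (\<lambda>(t, w). \<Phi> t w) \<in> borel_measurable (predictable_sigma \<gamma>)"

text \<open>A list of triples \<open>(a, b, \<xi>)\<close> stands for the simple process
  \<open>\<Sum> \<xi>(w) 1\<^bsub>(a,b]\<^esub>(t)\<close>.\<close>

type_synonym simple_process = "(real \<times> real \<times> (wpath \<Rightarrow> real)) list"

definition simple_eval :: "simple_process \<Rightarrow> real \<Rightarrow> wpath \<Rightarrow> real" where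
  "simple_eval S t w = (\<Sum>(a, b, \<xi>)\<leftarrow>S. \<xi> w * indicat_real {a<..b} t)"

definition simple_integral :: "simple_process \<Rightarrow> real \<Rightarrow> wpath \<Rightarrow> real" where
  "simple_integral S t w = (\<Sum>(a, b, \<xi>)\<leftarrow>S. \<xi> w * (w (min b t) - w (min a t)))"

definition simple_predictable :: "wpath measure \<Rightarrow> simple_process \<Rightarrow> bool" where
  "simple_predictable \<gamma> S \<longleftrightarrow> (\<forall>(a, b, \<xi>)\<in>set S. 0 \<le> a \<and> a \<le> b \<and> b \<le> 1 \<and>
     \<xi> \<in> borel_measurable (wiener_filtration \<gamma> a) \<and> (\<exists>C. \<forall>w\<in>wiener_paths. \<bar>\<xi> w\<bar> \<le> C))"

definition simple_deterministic :: "simple_process \<Rightarrow> bool" where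
  "simple_deterministic S \<longleftrightarrow> (\<forall>(a, b, \<xi>)\<in>set S. 0 \<le> a \<and> a \<le> b \<and> b \<le> 1 \<and> (\<exists>c. \<xi> = (\<lambda>_. c)))"

text \<open>\<open>Y\<close> is a version of the Wiener integral \<open>\<integral>\<^sub>0\<^sup>1 g(t) dw(t)\<close>: the \<open>L\<^sup>2(\<gamma>)\<close>-limit
  of the integrals of step functions that approximate \<open>g\<close> in \<open>L\<^sup>2[0,1]\<close>.\<close>

definition is_wiener_integral :: "wpath measure \<Rightarrow> (real \<Rightarrow> real) \<Rightarrow> (wpath \<Rightarrow> real) \<Rightarrow> bool" where
  "is_wiener_integral \<gamma> g Y \<longleftrightarrow>
     Y \<in> borel_measurable (completion \<gamma>) \<and>
     (\<exists>S :: nat \<Rightarrow> simple_process.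
        (\<forall>n. simple_deterministic (S n)) \<and>
        (\<lambda>n. \<integral>\<^sup>+t\<in>{0..1}. ennreal ((simple_eval (S n) t (\<lambda>_. 0) - g t)\<^sup>2) \<partial>lborel) \<longlonglongrightarrow> 0 \<and>
        (\<lambda>n. \<integral>\<^sup>+w. ennreal ((simple_integral (S n) 1 w - Y w)\<^sup>2) \<partial>completion \<gamma>) \<longlonglongrightarrow> 0)"

text \<open>\<open>X\<close> is a version of the Ito integral process \<open>(\<integral>\<^sub>0\<^sup>t \<Phi>(s) dW(s))\<^sub>t\<close> of a predictable
  \<open>\<Phi>\<close> whose square is almost surely integrable on \<open>[0,1]\<close>: the uniform limit in probability of
  the elementary integrals of simple predictable processes \<open>S\<^sub>n\<close> such that
  \<open>\<integral>\<^sub>0\<^sup>1 (S\<^sub>n - \<Phi>)\<^sup>2 ds\<close> tends to \<open>0\<close> in probability.\<close>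

definition is_ito_integral ::
    "wpath measure \<Rightarrow> (real \<Rightarrow> wpath \<Rightarrow> real) \<Rightarrow> (real \<Rightarrow> wpath \<Rightarrow> real) \<Rightarrow> bool" where
  "is_ito_integral \<gamma> \<Phi> X \<longleftrightarrow>
     (\<forall>t\<in>{0..1}. X t \<in> borel_measurable (wiener_filtration \<gamma> t)) \<and>
     (AE w in \<gamma>. continuous_on {0..1} (\<lambda>t. X t w)) \<and>
     (\<exists>S :: nat \<Rightarrow> simple_process.
        (\<forall>n. simple_predictable \<gamma> (S n)) \<and>
        (\<forall>\<epsilon>>0. (\<lambda>n. measure (completion \<gamma>) {w \<in> wiener_paths.
            (\<integral>\<^sup>+t\<in>{0..1}. ennreal ((simple_eval (S n) t w - \<Phi> t w)\<^sup>2) \<partial>lborel) > ennreal \<epsilon>}) \<longlonglongrightarrow> 0) \<and>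
        (\<forall>\<epsilon>>0. (\<lambda>n. measure (completion \<gamma>) {w \<in> wiener_paths.
            \<exists>t\<in>{0..1}. \<bar>simple_integral (S n) t w - X t w\<bar> > \<epsilon>}) \<longlonglongrightarrow> 0))"

definition wiener_martingale :: "wpath measure \<Rightarrow> (real \<Rightarrow> wpath \<Rightarrow> real) \<Rightarrow> bool" where
  "wiener_martingale \<gamma> M \<longleftrightarrow>
     (\<forall>t\<in>{0..1}. M t \<in> borel_measurable (wiener_filtration \<gamma> t) \<and> integrable (completion \<gamma>) (M t)) \<and>
     (\<forall>s\<in>{0..1}. \<forall>t\<in>{s..1}.
        AE w in \<gamma>. real_cond_exp (completion \<gamma>) (wiener_filtration \<gamma> s) (M t) w = M s w)"

text \<open>\<open>Zdot\<close> is the derivative process of the Cameron--Martin valued map \<open>Z\<close>.\<close>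

definition predictable_map ::
    "wpath measure \<Rightarrow> (wpath \<Rightarrow> wpath) \<Rightarrow> (real \<Rightarrow> wpath \<Rightarrow> real) \<Rightarrow> bool" where
  "predictable_map \<gamma> Z Zdot \<longleftrightarrow>
     predictable_process \<gamma> Zdot \<and>
     (AE w in \<gamma>. Z w \<in> cameron_martin \<and>
        (AE t in lborel. t \<in> {0..1} \<longrightarrow> (Z w has_real_derivative Zdot t w) (at t)) \<and>
        set_integrable lborel {0..1} (\<lambda>t. (Zdot t w)\<^sup>2))"

definition stoch_exp :: "(real \<Rightarrow> wpath \<Rightarrow> real) \<Rightarrow> (real \<Rightarrow> wpath \<Rightarrow> real) \<Rightarrow> real \<Rightarrow> wpath \<Rightarrow> real" where
  "stoch_exp Zdot X t w = exp (X t w - 1 / 2 * (LBINT s:{0..t}. (Zdot s w)\<^sup>2))"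


section \<open>Polynomial functionals and differential operators\<close>

text \<open>\<open>I h w\<close> stands for \<open>[h](w)\<close>. The versions of the Wiener integrals are chosen such that
  the shift convention holds pointwise, so that directional derivatives can be taken pointwise.\<close>

definition wiener_integral_family :: "wpath measure \<Rightarrow> (wpath \<Rightarrow> wpath \<Rightarrow> real) \<Rightarrow> bool" where
  "wiener_integral_family \<gamma> I \<longleftrightarrow>
     (\<forall>h\<in>cameron_martin. is_wiener_integral \<gamma> (deriv h) (I h)) \<and>
     (\<forall>h\<in>cameron_martin. \<forall>\<theta>\<in>cameron_martin. \<forall>w\<in>wiener_paths.
        I h (\<lambda>t. w t + \<theta> t) = I h w + cm_inner h \<theta>)"

text \<open>Polynomials in the variables \<open>x\<^sub>0, \<dots>, x\<^bsub>n-1\<^esub>\<close> are finitely supported maps from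
  monomials to coefficients, a monomial being a finitely supported map from variables to exponents.\<close>

definition mpoly_vars_below :: "nat \<Rightarrow> ((nat \<Rightarrow>\<^sub>0 nat) \<Rightarrow>\<^sub>0 real) \<Rightarrow> bool" where
  "mpoly_vars_below n p \<longleftrightarrow> (\<forall>m\<in>Poly_Mapping.keys p. Poly_Mapping.keys m \<subseteq> {..<n})"

definition mpoly_eval :: "((nat \<Rightarrow>\<^sub>0 nat) \<Rightarrow>\<^sub>0 real) \<Rightarrow> (nat \<Rightarrow> real) \<Rightarrow> real" where
  "mpoly_eval p x = (\<Sum>m\<in>Poly_Mapping.keys p.
     Poly_Mapping.lookup p m * (\<Prod>i\<in>Poly_Mapping.keys m. x i ^ Poly_Mapping.lookup m i))"

definition poly_functionals :: "(wpath \<Rightarrow> wpath \<Rightarrow> real) \<Rightarrow> (wpath \<Rightarrow> real) set" where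
  "poly_functionals I = {(\<lambda>w. mpoly_eval p (\<lambda>i. I (h i) w)) | n h p.
     (\<forall>i<n. h i \<in> cameron_martin) \<and> mpoly_vars_below n p}"

definition dir_deriv :: "wpath \<Rightarrow> (wpath \<Rightarrow> real) \<Rightarrow> wpath \<Rightarrow> real" where
  "dir_deriv \<theta> F w = Lim (at 0) (\<lambda>\<epsilon>. 1 / \<epsilon> * (F (\<lambda>t. w t + \<epsilon> * \<theta> t) - F w))"

text \<open>For \<open>is = [i\<^sub>1, \<dots>, i\<^sub>n]\<close>, the summand \<open>Y\<^bsub>i1\<^esub> \<cdots> Y\<^bsub>in\<^esub> D\<^bsub>i1\<^esub> \<cdots> D\<^bsub>in\<^esub> F\<close>; the case
  \<open>n = 0\<close> gives the identity.\<close>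

definition tensor_term ::
    "(nat \<Rightarrow> wpath) \<Rightarrow> (wpath \<Rightarrow> wpath) \<Rightarrow> (wpath \<Rightarrow> real) \<Rightarrow> wpath \<Rightarrow> nat list \<Rightarrow> real" where
  "tensor_term e Y F w is =
     (\<Prod>i\<leftarrow>is. cm_inner (Y w) (e i)) * foldr (\<lambda>i. dir_deriv (e i)) is F w"

definition D_tensor ::
    "(nat \<Rightarrow> wpath) \<Rightarrow> (wpath \<Rightarrow> wpath) \<Rightarrow> nat \<Rightarrow> (wpath \<Rightarrow> real) \<Rightarrow> wpath \<Rightarrow> real" where
  "D_tensor e Y n F w = (\<Sum>\<^sub>\<infinity>is\<in>{is. length is = n}. tensor_term e Y F w is)"

definition exp_D :: "(nat \<Rightarrow> wpath) \<Rightarrow> (wpath \<Rightarrow> wpath) \<Rightarrow> (wpath \<Rightarrow> real) \<Rightarrow> wpath \<Rightarrow> real" where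
  "exp_D e Y F w = suminf (\<lambda>n. 1 / fact n * D_tensor e Y n F w)"

text \<open>Existence is shown below; uniqueness is the uniqueness of power series coefficients.\<close>

definition hermite_hat :: "nat \<Rightarrow> real \<Rightarrow> real \<Rightarrow> real" where
  "hermite_hat = (SOME H. \<forall>l x y.
     (\<lambda>n. l ^ n / fact n * H n x y) sums exp (l * x - l\<^sup>2 / 2 * y))"

lemma hermite_hat_generating:
  "(\<lambda>n. l ^ n / fact n * hermite_hat n x y) sums exp (l * x - l\<^sup>2 / 2 * y)"
proof -
  define a where "a x n = x ^ n / fact n" for x :: real and n :: nat
  define b where "b y n = (if even n then (- y / 2) ^ (n div 2) / fact (n div 2) else 0)"
    for y :: real and n :: nat
  define H where "H n x y = fact n * (\<Sum>i\<le>n. a x i * b y (n - i))" for n x y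
  have "(\<lambda>n. l ^ n / fact n * H n x y) sums exp (l * x - l\<^sup>2 / 2 * y)" for l x y :: real
  proof -
    have exp_sums: "(\<lambda>n. z ^ n / fact n) sums exp z" for z :: real
      using exp_converges[of z] by (simp add: field_simps)
    have even_sums: "(\<lambda>n. if even n then z ^ (n div 2) / fact (n div 2) else 0) sums exp z"
      for z :: real
      using sums_if[OF sums_zero exp_sums[of z]] by simp
    have A: "(\<lambda>n. a x n * l ^ n) sums exp (l * x)"
      using exp_sums[of "l * x"] by (simp add: a_def power_mult_distrib mult.commute)
    have A': "summable (\<lambda>n. norm (a x n * l ^ n))"
      using summable_norm_exp[of "l * x"]
      by (simp add: a_def power_mult_distrib divide_inverse ac_simps abs_mult power_abs)
    have b_eq: "b y n * l ^ n =
        (if even n then (- (l\<^sup>2 / 2 * y)) ^ (n div 2) / fact (n div 2) else 0)" for n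
    proof (cases "even n")
      case True
      then obtain m where n: "n = 2 * m" by blast
      have "- (l\<^sup>2 / 2 * y) = (- y / 2) * l\<^sup>2" by simp
      then have "(- (l\<^sup>2 / 2 * y)) ^ m = (- y / 2) ^ m * l ^ (2 * m)"
        by (simp only: power_mult_distrib power_mult)
      then show ?thesis by (simp add: b_def n)
    qed (simp add: b_def)
    have B: "(\<lambda>n. b y n * l ^ n) sums exp (- (l\<^sup>2 / 2 * y))"
      unfolding b_eq by (rule even_sums)
    have "norm (b y n * l ^ n) =
        (if even n then \<bar>l\<^sup>2 / 2 * y\<bar> ^ (n div 2) / fact (n div 2) else 0)" for n
      unfolding b_eq by (simp add: power_abs)
    then have B': "summable (\<lambda>n. norm (b y n * l ^ n))"
      using even_sums[of "\<bar>l\<^sup>2 / 2 * y\<bar>"] by (simp add: sums_iff)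
    have "(\<lambda>n. \<Sum>i\<le>n. (a x i * l ^ i) * (b y (n - i) * l ^ (n - i)))
        sums (exp (l * x) * exp (- (l\<^sup>2 / 2 * y)))"
      using Cauchy_product_sums[OF A' B'] A B by (simp add: sums_iff)
    moreover have "(\<Sum>i\<le>n. (a x i * l ^ i) * (b y (n - i) * l ^ (n - i))) =
        l ^ n / fact n * H n x y" for n
    proof -
      have "(a x i * l ^ i) * (b y (n - i) * l ^ (n - i)) = l ^ n * (a x i * b y (n - i))"
        if "i \<le> n" for i
      proof -
        have "l ^ i * l ^ (n - i) = l ^ n"
          using that by (simp flip: power_add)
        then show ?thesis by (metis mult.assoc mult.commute)
      qed
      then have "(\<Sum>i\<le>n. (a x i * l ^ i) * (b y (n - i) * l ^ (n - i))) =
          (\<Sum>i\<le>n. l ^ n * (a x i * b y (n - i)))"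
        by (intro sum.cong) auto
      then show ?thesis by (simp add: H_def sum_distrib_left)
    qed
    moreover have "exp (l * x) * exp (- (l\<^sup>2 / 2 * y)) = exp (l * x - l\<^sup>2 / 2 * y)"
      by (simp add: exp_add[symmetric])
    ultimately show ?thesis by simp
  qed
  then have "\<exists>H. \<forall>l x y :: real. (\<lambda>n. l ^ n / fact n * H n x y) sums exp (l * x - l\<^sup>2 / 2 * y)"
    by blast
  from someI_ex[OF this] show ?thesis unfolding hermite_hat_def by blast
qed

definition path_minus :: "(wpath \<Rightarrow> wpath) \<Rightarrow> wpath \<Rightarrow> wpath" where
  "path_minus Z w = (\<lambda>t. - Z w t)"

definition L_op ::
    "(nat \<Rightarrow> wpath) \<Rightarrow> (wpath \<Rightarrow> wpath) \<Rightarrow> (real \<Rightarrow> wpath \<Rightarrow> real) \<Rightarrow> nat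
      \<Rightarrow> (wpath \<Rightarrow> real) \<Rightarrow> wpath \<Rightarrow> real" where
  "L_op e Z X n F w = (if n = 0 then F w else
     - (\<Sum>k=1..n. real (n choose k) * hermite_hat (n - k) (X 1 w) (cm_inner (Z w) (Z w))
           * D_tensor e (path_minus Z) k F w))"

end

theory Submission
  imports Defs
begin

text \<open>On a polynomial functional of degree \<open>N\<close> all derivatives of order greater than \<open>N\<close> vanish, so
  the exponential of \<open>D\<close> is a finite sum. Since \<open>1/n! (n choose k) = 1/k! 1/(n-k)!\<close>, the series of the \<open>L\<^sub>n\<close> is minus
  the Cauchy product of the series \<open>\<Sum> 1/m! H\<^sub>m\<close>, which is the stochastic exponential by the generating
  function at \<open>\<lambda> = 1\<close>, with the finite sum of the terms of order \<open>k \<ge> 1\<close>. The sums over multi-indices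
  converge absolutely: iterated derivatives of a product of Wiener integrals \<open>[h\<^sub>j]\<close> are combinations of
  products of the \<open>\<langle>h\<^sub>j, e\<^sub>i\<rangle>\<close>, and \<open>\<Sum>\<^sub>i \<bar>\<langle>Z, e\<^sub>i\<rangle> \<langle>h\<^sub>j, e\<^sub>i\<rangle>\<bar>\<close> is finite by Bessel's inequality. The shift
  convention is available only for Cameron--Martin paths, so these have to be shown to be closed under
  scaling.\<close>

section \<open>The Cameron--Martin space\<close>

text \<open>Rational increments suffice: by continuity the small increments violating the bound form
  an open set, which is empty once it misses \<open>\<rat>\<close>. All quantifiers become
  countable, so the condition can be shown to be Borel in \<open>x\<close>.\<close>

lemma has_real_derivative_iff_rational:
  fixes F :: "real \<Rightarrow> real"
  assumes cont: "continuous_on UNIV F"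
  shows "(F has_real_derivative d) (at x) \<longleftrightarrow>
    (\<forall>n::nat. \<exists>m::nat. \<forall>h\<in>\<rat>. \<bar>h\<bar> < 1 / real (Suc m) \<longrightarrow>
      \<bar>F (x + h) - F x - d * h\<bar> \<le> 1 / real (Suc n) * \<bar>h\<bar>)" (is "_ \<longleftrightarrow> ?R")
proof -
  have alt: "(F has_real_derivative d) (at x) \<longleftrightarrow>
      (\<forall>e>0. \<exists>r>0. \<forall>y. \<bar>y - x\<bar> < r \<longrightarrow> \<bar>F y - F x - d * (y - x)\<bar> \<le> e * \<bar>y - x\<bar>)"
    by (simp add: has_field_derivative_def has_derivative_at_alt bounded_linear_mult_right)
  show ?thesis
  proof
    assume L: "(F has_real_derivative d) (at x)"
    show ?R
    proof
      fix n :: nat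
      obtain r where r: "r > 0"
        "\<And>y. \<bar>y - x\<bar> < r \<Longrightarrow> \<bar>F y - F x - d * (y - x)\<bar> \<le> 1 / real (Suc n) * \<bar>y - x\<bar>"
        using L unfolding alt by (meson of_nat_0_less_iff zero_less_Suc zero_less_divide_1_iff)
      obtain m where m: "1 / real (Suc m) < r"
        using r(1) nat_approx_posE by blast
      have "\<bar>F (x + h) - F x - d * h\<bar> \<le> 1 / real (Suc n) * \<bar>h\<bar>" if "\<bar>h\<bar> < 1 / real (Suc m)" for h
        using r(2)[of "x + h"] that m by simp
      then show "\<exists>m::nat. \<forall>h\<in>\<rat>. \<bar>h\<bar> < 1 / real (Suc m) \<longrightarrow>
          \<bar>F (x + h) - F x - d * h\<bar> \<le> 1 / real (Suc n) * \<bar>h\<bar>"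
        by blast
    qed
  next
    assume R: ?R
    show "(F has_real_derivative d) (at x)"
      unfolding alt
    proof (intro allI impI)
      fix e :: real assume "e > 0"
      then obtain n where n: "1 / real (Suc n) < e"
        using nat_approx_posE by blast
      obtain m where m: "\<And>h. h \<in> \<rat> \<Longrightarrow> \<bar>h\<bar> < 1 / real (Suc m) \<Longrightarrow>
          \<bar>F (x + h) - F x - d * h\<bar> \<le> 1 / real (Suc n) * \<bar>h\<bar>"
        using R by blast
      let ?U = "{h. \<bar>h\<bar> < 1 / real (Suc m)} \<inter>
        {h. 1 / real (Suc n) * \<bar>h\<bar> < \<bar>F (x + h) - F x - d * h\<bar>}"
      have "open ?U"
        by (intro open_Int open_Collect_less continuous_intros continuous_on_compose2[OF cont]) auto
      moreover have "?U \<inter> \<rat> = {}"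
        using m by fastforce
      ultimately have "?U \<inter> closure \<rat> = {}"
        by (simp add: open_Int_closure_eq_empty)
      then have U: "?U = {}"
        by (simp add: Rats_closure_real)
      have "\<bar>F y - F x - d * (y - x)\<bar> \<le> e * \<bar>y - x\<bar>" if "\<bar>y - x\<bar> < 1 / real (Suc m)" for y
      proof -
        have "\<bar>F y - F x - d * (y - x)\<bar> \<le> 1 / real (Suc n) * \<bar>y - x\<bar>"
          using U that by (auto simp: set_eq_iff not_less dest!: spec[of _ "y - x"])
        also have "\<dots> \<le> e * \<bar>y - x\<bar>"
          using n by (intro mult_right_mono) auto
        finally show ?thesis .
      qed
      then show "\<exists>r>0. \<forall>y. \<bar>y - x\<bar> < r \<longrightarrow> \<bar>F y - F x - d * (y - x)\<bar> \<le> e * \<bar>y - x\<bar>"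
        by (intro exI[of _ "1 / real (Suc m)"]) auto
    qed
  qed
qed

lemma borel_has_real_derivative:
  fixes F g :: "real \<Rightarrow> real"
  assumes "continuous_on UNIV F" and [measurable]: "g \<in> borel_measurable borel"
  shows "{x. (F has_real_derivative g x) (at x)} \<in> sets borel"
proof -
  have [measurable]: "F \<in> borel_measurable borel"
    by (rule borel_measurable_continuous_onI[OF assms(1)])
  \<comment> \<open>Writing \<open>\<rat>\<close> as the range of \<open>of_rat\<close> turns the
    bounded quantifier into one over a countable type, which \<open>measurable\<close> can
    handle.\<close>
  show ?thesis
    unfolding has_real_derivative_iff_rational[OF assms(1)] Rats_def ball_simps by measurable
qed

section \<open>Cameron-Martin paths under scaling\<close>

text \<open>The cut-off turns set measurability and set integrals over \<open>{0..1}\<close> into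
  plain statements about \<open>lborel\<close>.\<close>

definition deriv01 :: "(real \<Rightarrow> real) \<Rightarrow> real \<Rightarrow> real" where
  "deriv01 h t = indicat_real {0..1} t * deriv h t"

lemma cameron_martinD:
  assumes "h \<in> cameron_martin"
  shows "h \<in> wiener_paths" "absolutely_continuous_fun {0..1} h"
    "AE t in lborel. t \<in> {0..1} \<longrightarrow> h differentiable at t"
    "deriv01 h \<in> borel_measurable borel"
    "integrable lborel (\<lambda>t. (deriv01 h t)\<^sup>2)"
proof -
  have "(deriv01 h t)\<^sup>2 = indicat_real {0..1} t * (deriv h t)\<^sup>2" for t
    by (auto simp: deriv01_def indicator_def)
  then show "h \<in> wiener_paths" "absolutely_continuous_fun {0..1} h"
    "AE t in lborel. t \<in> {0..1} \<longrightarrow> h differentiable at t"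
    "deriv01 h \<in> borel_measurable borel"
    "integrable lborel (\<lambda>t. (deriv01 h t)\<^sup>2)"
    using assms by (auto simp: cameron_martin_def square_integrable01_def set_borel_measurable_def
        set_integrable_def deriv01_def[abs_def])
qed

text \<open>\<open>deriv\<close> is a \<open>SOME\<close>; without a derivative its predicate is
  \<open>False\<close> for every value, so the choice depends neither on \<open>f\<close> nor on
  \<open>t\<close>.\<close>

lemma deriv_eq_default:
  fixes f :: "real \<Rightarrow> real"
  assumes "\<not> f differentiable at t"
  shows "deriv f t = (SOME D. False)"
  using assms unfolding deriv_def real_differentiable_def by auto

lemma deriv_cmult_real:
  fixes f :: "real \<Rightarrow> real"
  assumes "f differentiable at t"
  shows "deriv (\<lambda>t. c * f t) t = c * deriv f t"
  using assms by (intro deriv_cmult) (auto simp: field_differentiable_def real_differentiable_def)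

lemma differentiable_cmult_iff:
  fixes f :: "real \<Rightarrow> real"
  assumes "c \<noteq> 0"
  shows "(\<lambda>t. c * f t) differentiable at t \<longleftrightarrow> f differentiable at t"
proof
  assume "(\<lambda>t. c * f t) differentiable at t"
  then have "(\<lambda>t. inverse c * (c * f t)) differentiable at t"
    by (rule differentiable_mult[OF differentiable_const])
  then show "f differentiable at t"
    using assms by simp
qed (intro derivative_intros)

text \<open>Wherever \<open>h\<close> is differentiable inside the interval, its derivative is
  \<open>deriv01 h\<close>. So the set consists of the points at which one fixed Borel function is
  the derivative.\<close>

lemma cameron_martin_differentiable_borel:
  assumes h: "h \<in> cameron_martin"
  shows "{t \<in> {0<..<1}. h differentiable at t} \<in> sets borel"
proof -
  \<comment> \<open>\<open>h\<close> may jump to 0 to the right of 1. Freezing it at its endpoint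
    values gives a function that is continuous on the whole line and has the same derivatives in the
    open interval.\<close>
  define F where "F t = h (max 0 (min 1 t))" for t :: real
  have "continuous_on {0..1} h"
    using cameron_martinD(1)[OF h] by (simp add: wiener_paths_def)
  then have "continuous_on UNIV F"
    unfolding F_def by (rule continuous_on_compose2) (auto intro!: continuous_intros)
  then have "{t. (F has_real_derivative deriv01 h t) (at t)} \<in> sets borel"
    by (rule borel_has_real_derivative) (rule cameron_martinD(4)[OF h])
  moreover have "h differentiable at t \<longleftrightarrow> (F has_real_derivative deriv01 h t) (at t)"
    if t: "t \<in> {0<..<1}" for t
  proof -
    have ev: "eventually (\<lambda>s. s \<in> {0<..<1}) (nhds t)"
      using t by (intro eventually_nhds_in_open) auto
    have "(F has_real_derivative deriv01 h t) (at t) \<longleftrightarrow> (h has_real_derivative deriv01 h t) (at t)"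
      by (intro DERIV_cong_ev refl eventually_mono[OF ev]) (auto simp: F_def max_def min_def)
    also have "\<dots> \<longleftrightarrow> h differentiable at t"
      using t by (auto simp: deriv01_def real_differentiable_def indicator_def
          DERIV_deriv_iff_has_field_derivative[symmetric] DERIV_imp_deriv)
    finally show ?thesis by simp
  qed
  then have "{t \<in> {0<..<1}. h differentiable at t} =
      {0<..<1} \<inter> {t. (F has_real_derivative deriv01 h t) (at t)}"
    by auto
  ultimately show ?thesis by simp
qed

lemma deriv_cmult_AE:
  assumes "h \<in> cameron_martin"
  shows "AE t in lborel. deriv01 (\<lambda>t. c * h t) t = c * deriv01 h t"
  using cameron_martinD(3)[OF assms]
  by eventually_elim (auto simp: deriv01_def deriv_cmult_real indicator_def)

text \<open>Off the differentiability set \<^const>\<open>deriv\<close> takes one fixed value, which does not scale;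
  hence measurability of the scaled derivative needs the differentiability set to be Borel.\<close>

lemma borel_measurable_deriv_cmult:
  assumes h: "h \<in> cameron_martin" and c: "c \<noteq> 0"
  shows "deriv01 (\<lambda>t. c * h t) \<in> borel_measurable borel"
proof -
  define D where "D = {t \<in> {0<..<1}. h differentiable at t}"
  have [measurable]: "D \<in> sets borel"
    unfolding D_def by (rule cameron_martin_differentiable_borel[OF h])
  note [measurable] = cameron_martinD(4)[OF h]
  define k :: "real \<Rightarrow> real" where "k = deriv (\<lambda>t. c * h t)"
  \<comment> \<open>\<open>D\<close> lies in the open interval; at the two endpoints the values are
    kept as the constants \<open>k 0\<close> and \<open>k 1\<close>, whatever they are.\<close>
  have "deriv01 (\<lambda>t. c * h t) = (\<lambda>t. if t \<in> D then c * deriv01 h t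
      else if t \<in> {0<..<1} then (SOME D. False)
      else if t = 0 then k 0 else if t = 1 then k 1 else 0)"
    using c by (auto simp: fun_eq_iff D_def k_def deriv01_def deriv_cmult_real deriv_eq_default
        differentiable_cmult_iff indicator_def)
  then show ?thesis by simp
qed

lemma absolutely_continuous_fun_cmult:
  assumes f: "absolutely_continuous_fun S f"
  shows "absolutely_continuous_fun S (\<lambda>t. c * f t)"
  unfolding absolutely_continuous_fun_def
proof (intro allI impI)
  fix e :: real assume "e > 0"
  \<comment> \<open>Adding 1 covers \<open>c = 0\<close>.\<close>
  then have "e / (\<bar>c\<bar> + 1) > 0" by simp
  then obtain d where d: "d > 0" and *: "\<And>(n::nat) a b.
        (\<forall>i<n. a i \<le> b i \<and> {a i..b i} \<subseteq> S) \<and>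
        disjoint_family_on (\<lambda>i. {a i<..<b i}) {..<n} \<and>
        (\<Sum>i<n. b i - a i) < d
        \<longrightarrow> (\<Sum>i<n. \<bar>f (b i) - f (a i)\<bar>) < e / (\<bar>c\<bar> + 1)"
    using f unfolding absolutely_continuous_fun_def by blast
  have "(\<Sum>i<n. \<bar>c * f (b i) - c * f (a i)\<bar>) < e"
    if "(\<forall>i<n. a i \<le> b i \<and> {a i..b i} \<subseteq> S) \<and> disjoint_family_on (\<lambda>i. {a i<..<b i}) {..<n} \<and>
        (\<Sum>i<n. b i - a i) < d" for n :: nat and a b
  proof -
    let ?s = "\<Sum>i<n. \<bar>f (b i) - f (a i)\<bar>"
    have "(\<Sum>i<n. \<bar>c * f (b i) - c * f (a i)\<bar>) = \<bar>c\<bar> * ?s"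
      by (simp add: sum_distrib_left abs_mult flip: right_diff_distrib)
    also have "\<dots> \<le> (\<bar>c\<bar> + 1) * ?s"
      by (intro mult_right_mono sum_nonneg) auto
    also have "\<dots> < e"
      using *[of n a b] that by (simp add: pos_less_divide_eq mult.commute)
    finally show ?thesis .
  qed
  with d show "\<exists>d>0. \<forall>(n::nat) a b.
        (\<forall>i<n. a i \<le> b i \<and> {a i..b i} \<subseteq> S) \<and>
        disjoint_family_on (\<lambda>i. {a i<..<b i}) {..<n} \<and>
        (\<Sum>i<n. b i - a i) < d
        \<longrightarrow> (\<Sum>i<n. \<bar>c * f (b i) - c * f (a i)\<bar>) < e"
    by blast
qed

lemma wiener_paths_add_cmult:
  assumes "w \<in> wiener_paths" "h \<in> wiener_paths"
  shows "(\<lambda>t. w t + c * h t) \<in> wiener_paths"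
  using assms by (auto simp: wiener_paths_def intro!: continuous_intros)

text \<open>Used with a step size \<open>\<epsilon>\<close> for directional derivatives and with
  \<open>-1\<close> to pass from \<open>Z w\<close> to \<open>path_minus Z w\<close>.\<close>

lemma cameron_martin_cmult:
  assumes h: "h \<in> cameron_martin" and c: "c \<noteq> 0"
  shows "(\<lambda>t. c * h t) \<in> cameron_martin"
proof -
  have "(\<lambda>t. c * h t) \<in> wiener_paths"
    using cameron_martinD(1)[OF h] by (auto simp: wiener_paths_def intro!: continuous_intros)
  moreover have "AE t in lborel. t \<in> {0..1} \<longrightarrow> (\<lambda>t. c * h t) differentiable at t"
    using cameron_martinD(3)[OF h] c by (simp add: differentiable_cmult_iff)
  moreover have "square_integrable01 (deriv (\<lambda>t. c * h t))"
  proof -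
    note [measurable] = borel_measurable_deriv_cmult[OF h c] cameron_martinD(4)[OF h]
    have "integrable lborel (\<lambda>t. c\<^sup>2 * (deriv01 h t)\<^sup>2)"
      using cameron_martinD(5)[OF h] by simp
    then have "integrable lborel (\<lambda>t. (deriv01 (\<lambda>t. c * h t) t)\<^sup>2)"
      by (rule integrable_cong_AE_imp)
        (measurable, use deriv_cmult_AE[OF h, of c] in eventually_elim, simp add: power_mult_distrib)
    moreover have "(deriv01 (\<lambda>t. c * h t) t)\<^sup>2 =
        indicat_real {0..1} t * (deriv (\<lambda>t. c * h t) t)\<^sup>2" for t
      by (auto simp: deriv01_def indicator_def)
    ultimately show ?thesis
      using borel_measurable_deriv_cmult[OF h c]
      by (simp add: square_integrable01_def set_borel_measurable_def set_integrable_def deriv01_def[abs_def])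
  qed
  ultimately show ?thesis
    using absolutely_continuous_fun_cmult[OF cameron_martinD(2)[OF h]]
    by (simp add: cameron_martin_def)
qed

lemma cm_inner_eq_integral:
  "cm_inner h k = (\<integral>t. deriv01 h t * deriv01 k t \<partial>lborel)"
  unfolding cm_inner_def set_lebesgue_integral_def
  by (intro Bochner_Integration.integral_cong) (auto simp: deriv01_def indicator_def)

lemma cm_inner_cmult_right:
  assumes "h \<in> cameron_martin" "k \<in> cameron_martin" "c \<noteq> 0"
  shows "cm_inner h (\<lambda>t. c * k t) = c * cm_inner h k"
proof -
  note [measurable] = borel_measurable_deriv_cmult[OF assms(2,3)] cameron_martinD(4)[OF assms(1)]
    cameron_martinD(4)[OF assms(2)]
  have "cm_inner h (\<lambda>t. c * k t) = (\<integral>t. c * (deriv01 h t *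
      deriv01 k t) \<partial>lborel)"
    unfolding cm_inner_eq_integral
    by (rule integral_cong_AE) (measurable, use deriv_cmult_AE[OF assms(2), of c] in eventually_elim, simp)
  then show ?thesis
    by (simp add: cm_inner_eq_integral)
qed

section \<open>Bessel's inequality and square-summable coefficients\<close>

lemma abs_mult_le_sum_squares: "\<bar>a * b\<bar> \<le> a\<^sup>2 + b\<^sup>2" for a b :: real
proof -
  have "2 * \<bar>a * b\<bar> \<le> a\<^sup>2 + b\<^sup>2"
    using sum_squares_bound[of "\<bar>a\<bar>" "\<bar>b\<bar>"] by (simp add: abs_mult)
  then show ?thesis by linarith
qed

lemma integrable_mult_square_integrable:
  fixes f g :: "'a \<Rightarrow> real"
  assumes [measurable]: "f \<in> borel_measurable M" "g \<in> borel_measurable M"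
    and "integrable M (\<lambda>x. (f x)\<^sup>2)" "integrable M (\<lambda>x. (g x)\<^sup>2)"
  shows "integrable M (\<lambda>x. f x * g x)"
proof (rule Bochner_Integration.integrable_bound)
  show "integrable M (\<lambda>x. (f x)\<^sup>2 + (g x)\<^sup>2)"
    using assms by simp
  show "AE x in M. norm (f x * g x) \<le> norm ((f x)\<^sup>2 + (g x)\<^sup>2)"
    by (simp add: abs_mult_le_sum_squares)
qed simp

text \<open>Expand the nonnegative integral of the squared difference between \<open>f\<close> and
  its projection onto the span of the \<open>g i\<close>.\<close>

lemma Bessel_inequality:
  fixes f :: "'a \<Rightarrow> real" and g :: "'i \<Rightarrow> 'a \<Rightarrow> real"
  assumes f: "f \<in> borel_measurable M" "integrable M (\<lambda>x. (f x)\<^sup>2)"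
    and g: "\<And>i. i \<in> A \<Longrightarrow> g i \<in> borel_measurable M" "\<And>i. i \<in> A \<Longrightarrow> integrable M (\<lambda>x. (g i x)\<^sup>2)"
    and on: "\<And>i j. i \<in> A \<Longrightarrow> j \<in> A \<Longrightarrow> (\<integral>x. g i x * g j x \<partial>M) = (if i = j then 1 else 0)"
    and A: "finite A"
  shows "(\<Sum>i\<in>A. (\<integral>x. f x * g i x \<partial>M)\<^sup>2) \<le> (\<integral>x. (f x)\<^sup>2 \<partial>M)"
proof -
  define c where "c i = (\<integral>x. f x * g i x \<partial>M)" for i
  have fg: "integrable M (\<lambda>x. f x * g i x)" if "i \<in> A" for i
    using f g that by (intro integrable_mult_square_integrable)
  have gg: "integrable M (\<lambda>x. g i x * g j x)" if "i \<in> A" "j \<in> A" for i j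
    using g that by (intro integrable_mult_square_integrable)
  have "(f x - (\<Sum>i\<in>A. c i * g i x))\<^sup>2 =
      (f x)\<^sup>2 - 2 * (\<Sum>i\<in>A. c i * (f x * g i x)) + (\<Sum>i\<in>A. \<Sum>j\<in>A. c i * c j * (g i x * g j x))" for x
    by (simp add: power2_diff power2_eq_square[of "sum _ _"] sum_product sum_distrib_left mult_ac)
  then have "(\<integral>x. (f x - (\<Sum>i\<in>A. c i * g i x))\<^sup>2 \<partial>M) =
      (\<integral>x. (f x)\<^sup>2 \<partial>M) - 2 * (\<Sum>i\<in>A. c i * c i) + (\<Sum>i\<in>A. \<Sum>j\<in>A. c i * c j * (\<integral>x. g i x * g j x \<partial>M))"
    using f fg gg by (simp add: Bochner_Integration.integral_sum Bochner_Integration.integrable_sum c_def)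
  also have "(\<Sum>i\<in>A. \<Sum>j\<in>A. c i * c j * (\<integral>x. g i x * g j x \<partial>M)) = (\<Sum>i\<in>A. c i * c i)"
    using A by (simp add: on if_distrib cong: sum.cong if_cong)
  finally have "(\<integral>x. (f x - (\<Sum>i\<in>A. c i * g i x))\<^sup>2 \<partial>M) = (\<integral>x. (f x)\<^sup>2 \<partial>M) - (\<Sum>i\<in>A. (c i)\<^sup>2)"
    by (simp add: power2_eq_square)
  moreover have "0 \<le> (\<integral>x. (f x - (\<Sum>i\<in>A. c i * g i x))\<^sup>2 \<partial>M)"
    by (rule Bochner_Integration.integral_nonneg) simp
  ultimately show ?thesis by (simp add: c_def)
qed

lemma cm_inner_square_summable:
  assumes e: "complete_orthonormal_system e" and h: "h \<in> cameron_martin"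
  shows "(\<lambda>i. (cm_inner h (e i))\<^sup>2) summable_on UNIV"
proof (rule nonneg_bdd_above_summable_on)
  have "(\<Sum>i\<in>A. (cm_inner h (e i))\<^sup>2) \<le> cm_inner h h" if "finite A" for A
  proof -
    have e_cm: "e i \<in> cameron_martin"
      and e_on: "cm_inner (e i) (e j) = (if i = j then 1 else 0)" for i j
      using e by (simp_all add: complete_orthonormal_system_def)
    have "(\<Sum>i\<in>A. (\<integral>t. deriv01 h t * deriv01 (e i) t \<partial>lborel)\<^sup>2)
      \<le> (\<integral>t. (deriv01 h t)\<^sup>2 \<partial>lborel)"
      using that cameron_martinD(4,5)[OF h] cameron_martinD(4,5)[OF e_cm] e_on
      by (intro Bessel_inequality) (simp_all add: cm_inner_eq_integral)
    then show ?thesis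
      by (simp add: cm_inner_eq_integral power2_eq_square)
  qed
  then show "bdd_above (sum (\<lambda>i. (cm_inner h (e i))\<^sup>2) ` {F. F \<subseteq> UNIV \<and> finite F})"
    by (auto simp: bdd_above_def)
qed simp

lemma summable_on_mult_square_summable:
  fixes a b :: "'a \<Rightarrow> real"
  assumes "(\<lambda>i. (a i)\<^sup>2) summable_on A" "(\<lambda>i. (b i)\<^sup>2) summable_on A"
  shows "(\<lambda>i. a i * b i) summable_on A"
proof -
  have "(\<lambda>i. (a i)\<^sup>2 + (b i)\<^sup>2) summable_on A"
    using assms by (rule summable_on_add)
  then have "(\<lambda>i. norm (a i * b i)) summable_on A"
    by (rule summable_on_comparison_test) (auto simp: abs_mult_le_sum_squares)
  then show ?thesis
    by (rule abs_summable_summable)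
qed

lemma summable_on_sum:
  fixes f :: "'j \<Rightarrow> 'a \<Rightarrow> real"
  assumes "\<And>j. j \<in> J \<Longrightarrow> f j summable_on A"
  shows "(\<lambda>x. \<Sum>j\<in>J. f j x) summable_on A"
  using assms by (induction J rule: infinite_finite_induct) (auto intro: summable_on_add)

section \<open>Derivatives of polynomial functionals\<close>

text \<open>For \<open>\<epsilon> \<noteq> 0\<close> the scaled direction is again a Cameron-Martin
  path, so the shift convention applies to it; the zero step is trivial.\<close>

lemma wiener_integral_shift:
  assumes I: "wiener_integral_family \<gamma> I" and h: "h \<in> cameron_martin" and \<theta>: "\<theta> \<in> cameron_martin"
    and w: "w \<in> wiener_paths"
  shows "I h (\<lambda>t. w t + \<epsilon> * \<theta> t) = I h w + \<epsilon> * cm_inner h \<theta>"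
proof (cases "\<epsilon> = 0")
  case False
  have "I h (\<lambda>t. w t + \<eta> t) = I h w + cm_inner h \<eta>" if "\<eta> \<in> cameron_martin" for \<eta>
    using I h w that unfolding wiener_integral_family_def by blast
  from this[OF cameron_martin_cmult[OF \<theta> False]]
  have "I h (\<lambda>t. w t + \<epsilon> * \<theta> t) = I h w + cm_inner h (\<lambda>t. \<epsilon> * \<theta> t)" .
  then show ?thesis
    by (simp add: cm_inner_cmult_right[OF h \<theta> False])
qed simp

section \<open>Directional derivatives of products of Wiener integrals\<close>

text \<open>\<open>dir_deriv\<close> is a \<open>Lim\<close>, which has a value even without
  convergence. This predicate asserts that the limit exists and makes the rules for real derivatives
  available.\<close>

definition has_dir_deriv :: "wpath \<Rightarrow> (wpath \<Rightarrow> real) \<Rightarrow> (wpath \<Rightarrow> real) \<Rightarrow> bool" where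
  "has_dir_deriv \<theta> F F' \<longleftrightarrow>
    (\<forall>w\<in>wiener_paths. ((\<lambda>\<epsilon>. F (\<lambda>t. w t + \<epsilon> * \<theta> t)) has_real_derivative F' w) (at 0))"

lemma has_dir_deriv_sum:
  assumes "\<And>j. j \<in> A \<Longrightarrow> has_dir_deriv \<theta> (F j) (F' j)"
  shows "has_dir_deriv \<theta> (\<lambda>w. \<Sum>j\<in>A. c j * F j w) (\<lambda>w. \<Sum>j\<in>A. c j * F' j w)"
  using assms unfolding has_dir_deriv_def by (auto intro!: DERIV_sum DERIV_cmult)

text \<open>Agreement on \<open>wiener_paths\<close> is enough because the shifted path stays there.
  So a derivative known only on Wiener paths can be differentiated again.\<close>

lemma dir_deriv_eqI:
  assumes \<theta>: "\<theta> \<in> wiener_paths" and w: "w \<in> wiener_paths"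
    and F: "\<And>v. v \<in> wiener_paths \<Longrightarrow> F v = G v" and G: "has_dir_deriv \<theta> G G'"
  shows "dir_deriv \<theta> F w = G' w"
proof -
  have eq: "F (\<lambda>t. w t + \<epsilon> * \<theta> t) = G (\<lambda>t. w t + \<epsilon> * \<theta> t)" for \<epsilon>
    by (intro F wiener_paths_add_cmult w \<theta>)
  have "((\<lambda>\<epsilon>. (G (\<lambda>t. w t + \<epsilon> * \<theta> t) - G w) / \<epsilon>) \<longlongrightarrow> G' w) (at 0)"
    using G w unfolding has_dir_deriv_def DERIV_def by fastforce
  then have "((\<lambda>\<epsilon>. 1 / \<epsilon> * (F (\<lambda>t. w t + \<epsilon> * \<theta> t) - F w)) \<longlongrightarrow> G' w) (at 0)"
    by (simp add: eq F[OF w])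
  then show ?thesis
    unfolding dir_deriv_def by (intro tendsto_Lim) auto
qed

text \<open>The iterated derivative of \<open>\<Prod>j\<in>J. I (g j)\<close> along \<open>e i\<close>, \<open>i \<in> is\<close>, by the product rule.\<close>

primrec monomial_deriv ::
    "(wpath \<Rightarrow> wpath \<Rightarrow> real) \<Rightarrow> (nat \<Rightarrow> wpath) \<Rightarrow> ('j \<Rightarrow> wpath) \<Rightarrow> nat list \<Rightarrow> 'j set \<Rightarrow> wpath \<Rightarrow> real" where
  "monomial_deriv I e g [] J w = (\<Prod>j\<in>J. I (g j) w)"
| "monomial_deriv I e g (i # is) J w =
    (\<Sum>j\<in>J. cm_inner (g j) (e i) * monomial_deriv I e g is (J - {j}) w)"

text \<open>For the empty list each factor is affine in \<open>\<epsilon>\<close> and the product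
  rule applies. In the induction step the derivative passes through the sum and its coefficients,
  which do not depend on \<open>w\<close>.\<close>

lemma has_dir_deriv_monomial_deriv:
  assumes I: "wiener_integral_family \<gamma> I" and g: "\<And>j. j \<in> J \<Longrightarrow> g j \<in> cameron_martin"
    and e: "e i \<in> cameron_martin" and J: "finite J"
  shows "has_dir_deriv (e i) (monomial_deriv I e g is J) (monomial_deriv I e g (i # is) J)"
  using g J
proof (induction "is" arbitrary: J)
  case Nil
  show ?case
    unfolding has_dir_deriv_def
  proof
    fix w assume w: "w \<in> wiener_paths"
    have "((\<lambda>\<epsilon>. \<Prod>j\<in>J. I (g j) w + \<epsilon> * cm_inner (g j) (e i)) has_real_derivative
        (\<Sum>j\<in>J. cm_inner (g j) (e i) * (\<Prod>k\<in>J - {j}. I (g k) w + 0 * cm_inner (g k) (e i)))) (at 0)"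
      by (rule has_field_derivative_prod) (auto intro!: derivative_eq_intros)
    moreover have "(\<Prod>j\<in>J. I (g j) (\<lambda>t. w t + \<epsilon> * e i t)) =
        (\<Prod>j\<in>J. I (g j) w + \<epsilon> * cm_inner (g j) (e i))" for \<epsilon>
      using Nil by (intro prod.cong refl wiener_integral_shift[OF I _ e w])
    ultimately show "((\<lambda>\<epsilon>. monomial_deriv I e g [] J (\<lambda>t. w t + \<epsilon> * e i t)) has_real_derivative
        monomial_deriv I e g [i] J w) (at 0)"
      by simp
  qed
next
  case (Cons k "is")
  have "has_dir_deriv (e i) (\<lambda>w. \<Sum>j\<in>J. cm_inner (g j) (e k) * monomial_deriv I e g is (J - {j}) w)
     (\<lambda>w. \<Sum>j\<in>J. cm_inner (g j) (e k) * monomial_deriv I e g (i # is) (J - {j}) w)"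
    using Cons.prems by (intro has_dir_deriv_sum Cons.IH) auto
  \<comment> \<open>The left side first picks a factor \<open>j\<close> for \<open>k\<close>, then
    another factor \<open>l\<close> for \<open>i\<close>; the recursion picks them in the opposite
    order. Both run over ordered pairs of distinct factors, so the sums can be swapped.\<close>
  moreover have "(\<Sum>j\<in>J. cm_inner (g j) (e k) * monomial_deriv I e g (i # is) (J - {j}) w) =
      monomial_deriv I e g (i # k # is) J w" for w
  proof -
    let ?t = "\<lambda>j l. cm_inner (g j) (e k) * (cm_inner (g l) (e i) * monomial_deriv I e g is (J - {j} - {l}) w)"
    have del: "J - {j} = {l \<in> J. l \<noteq> j}" for j by auto
    have "(\<Sum>j\<in>J. \<Sum>l\<in>J - {j}. ?t j l) = (\<Sum>l\<in>J. \<Sum>j\<in>{j \<in> J. l \<noteq> j}. ?t j l)"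
      unfolding del[of "_ :: 'a"]
      using Cons.prems(2) by (subst sum.swap_restrict) auto
    also have "\<dots> = (\<Sum>l\<in>J. \<Sum>j\<in>J - {l}. ?t j l)"
      by (intro sum.cong refl) auto
    finally have "(\<Sum>j\<in>J. \<Sum>l\<in>J - {j}. ?t j l) = (\<Sum>l\<in>J. \<Sum>j\<in>J - {l}. ?t j l)" .
    moreover have "J - {j} - {l} = J - {l} - {j}" for j l by auto
    ultimately show ?thesis
      by (simp add: sum_distrib_left mult_ac)
  qed
  ultimately show ?case by simp
qed

text \<open>Every derivative removes one factor; once none is left, the next derivative is an empty
  sum.\<close>

lemma monomial_deriv_eq_0:
  assumes "finite J" "card J < length is"
  shows "monomial_deriv I e g is J w = 0"
  using assms
proof (induction "is" arbitrary: J)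
  case (Cons i "is")
  have "monomial_deriv I e g is (J - {j}) w = 0" if "j \<in> J" for j
    using Cons.prems that card_gt_0_iff[of J] by (intro Cons.IH) (auto simp: card_Diff_singleton)
  then show ?case by simp
qed simp

section \<open>Absolute convergence over multi-indices\<close>

text \<open>A list of length \<open>Suc n\<close> is a pair of head and tail. Real summability over
  a set is absolute, so the products are summable over all pairs.\<close>

lemma summable_on_lists_Suc:
  fixes f :: "'a \<Rightarrow> real" and G :: "'a list \<Rightarrow> real"
  assumes f: "f summable_on UNIV" and G: "G summable_on {is. length is = n}"
  shows "(\<lambda>is. f (hd is) * G (tl is)) summable_on {is. length is = Suc n}"
proof -
  let ?B = "{is :: 'a list. length is = n}"
  have f': "(\<lambda>i. \<bar>f i\<bar>) summable_on UNIV" and G': "(\<lambda>is. \<bar>G is\<bar>) summable_on ?B"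
    using f G summable_on_iff_abs_summable_on_real unfolding real_norm_def by blast+
  have "(\<lambda>i. \<bar>f i\<bar> * (\<Sum>\<^sub>\<infinity>is\<in>?B. \<bar>G is\<bar>)) summable_on UNIV"
    by (rule summable_on_cmult_left[OF f'])
  then have "(\<lambda>(i, is). \<bar>f i\<bar> * \<bar>G is\<bar>) summable_on UNIV \<times> ?B"
    by (intro summable_on_SigmaI[where g = "\<lambda>i. \<bar>f i\<bar> * (\<Sum>\<^sub>\<infinity>is\<in>?B. \<bar>G is\<bar>)"])
      (simp_all add: has_sum_cmult_right[OF has_sum_infsum[OF G']])
  then have "(\<lambda>x. norm (case x of (i, is) \<Rightarrow> f i * G is)) summable_on UNIV \<times> ?B"
    by (simp add: case_prod_unfold abs_mult)
  then have "(\<lambda>(i, is). f i * G is) summable_on UNIV \<times> ?B"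
    by (rule abs_summable_summable)
  moreover have "{is. length is = Suc n} = (\<lambda>(i, is). i # is) ` (UNIV \<times> ?B)"
    by (auto simp: length_Suc_conv image_iff)
  moreover have "inj_on (\<lambda>(i, is). i # is) (UNIV \<times> ?B)"
    by (auto simp: inj_on_def)
  ultimately show ?thesis
    by (simp add: summable_on_reindex o_def case_prod_unfold)
qed

text \<open>Splitting off the head \<open>i\<close> leaves, for each removed factor
  \<open>j\<close>, the weight \<open>cm_inner y (e i) * cm_inner (g j) (e i)\<close>, a product of
  two square-summable sequences; the tail is covered by induction.\<close>

lemma monomial_deriv_summable:
  assumes e: "complete_orthonormal_system e" and y: "y \<in> cameron_martin"
    and g: "\<And>j. j \<in> J \<Longrightarrow> g j \<in> cameron_martin"
  shows "(\<lambda>is. (\<Prod>i\<leftarrow>is. cm_inner y (e i)) * monomial_deriv I e g is J w)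
    summable_on {is. length is = n}"
  using g
proof (induction n arbitrary: J)
  case (Suc n)
  have "(\<lambda>is. (cm_inner y (e (hd is)) * cm_inner (g j) (e (hd is))) *
      ((\<Prod>i\<leftarrow>tl is. cm_inner y (e i)) * monomial_deriv I e g (tl is) (J - {j}) w))
    summable_on {is. length is = Suc n}" if "j \<in> J" for j
  proof (rule summable_on_lists_Suc)
    show "(\<lambda>i. cm_inner y (e i) * cm_inner (g j) (e i)) summable_on UNIV"
      using Suc.prems that
      by (intro summable_on_mult_square_summable cm_inner_square_summable e y) auto
    show "(\<lambda>is. (\<Prod>i\<leftarrow>is. cm_inner y (e i)) * monomial_deriv I e g is (J - {j}) w)
        summable_on {is. length is = n}"
      using Suc.prems by (intro Suc.IH) auto
  qed
  then have "(\<lambda>is. \<Sum>j\<in>J. (cm_inner y (e (hd is)) * cm_inner (g j) (e (hd is))) *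
      ((\<Prod>i\<leftarrow>tl is. cm_inner y (e i)) * monomial_deriv I e g (tl is) (J - {j}) w))
    summable_on {is. length is = Suc n}"
    by (rule summable_on_sum)
  then show ?case
    by (rule summable_on_cong[THEN iffD1, rotated])
      (auto simp: length_Suc_conv sum_distrib_left mult_ac)
qed simp

section \<open>Polynomial functionals\<close>

text \<open>One element per factor of the monomial, counted with multiplicity: powers become
  products of separately indexed factors, the form that \<open>monomial_deriv\<close>
  differentiates.\<close>

definition mpoly_occurrences :: "(nat \<Rightarrow>\<^sub>0 nat) \<Rightarrow> (nat \<times> nat) set" where
  "mpoly_occurrences m = (SIGMA i:Poly_Mapping.keys m. {..<Poly_Mapping.lookup m i})"

lemma finite_mpoly_occurrences: "finite (mpoly_occurrences m)"
  by (simp add: mpoly_occurrences_def)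

lemma mpoly_eval_eq_sum_monomials:
  "mpoly_eval p x = (\<Sum>m\<in>Poly_Mapping.keys p. Poly_Mapping.lookup p m * (\<Prod>j\<in>mpoly_occurrences m. x (fst j)))"
proof -
  have "(\<Prod>j\<in>mpoly_occurrences m. x (fst j)) =
      (\<Prod>i\<in>Poly_Mapping.keys m. \<Prod>k<Poly_Mapping.lookup m i. x i)" for m
    unfolding mpoly_occurrences_def by (subst prod.Sigma) (auto simp: case_prod_unfold)
  then show ?thesis
    by (simp add: mpoly_eval_def)
qed

text \<open>Induction with \<open>w\<close> arbitrary: the formula for the tail holds on all Wiener
  paths, as \<open>dir_deriv_eqI\<close> demands for one more derivative.\<close>

lemma foldr_dir_deriv_poly:
  assumes I: "wiener_integral_family \<gamma> I" and e: "\<And>i. e i \<in> cameron_martin"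
    and J: "\<And>m. m \<in> K \<Longrightarrow> finite (J m)" and g: "\<And>m j. m \<in> K \<Longrightarrow> j \<in> J m \<Longrightarrow> g j \<in> cameron_martin"
    and F: "\<And>w. F w = (\<Sum>m\<in>K. c m * (\<Prod>j\<in>J m. I (g j) w))" and w: "w \<in> wiener_paths"
  shows "foldr (\<lambda>i. dir_deriv (e i)) is F w = (\<Sum>m\<in>K. c m * monomial_deriv I e g is (J m) w)"
  using w
proof (induction "is" arbitrary: w)
  case (Cons i "is")
  have "has_dir_deriv (e i) (\<lambda>w. \<Sum>m\<in>K. c m * monomial_deriv I e g is (J m) w)
      (\<lambda>w. \<Sum>m\<in>K. c m * monomial_deriv I e g (i # is) (J m) w)"
    using g J e by (intro has_dir_deriv_sum has_dir_deriv_monomial_deriv[OF I]) auto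
  from dir_deriv_eqI[OF cameron_martinD(1)[OF e] Cons.prems Cons.IH this]
  show ?case by simp
qed (simp add: F)

text \<open>\<open>N\<close> depends on \<open>F\<close> but not on \<open>Y\<close> or
  \<open>w\<close>, so one cutoff serves every path.\<close>

lemma poly_functional_tensor:
  assumes I: "wiener_integral_family \<gamma> I" and e: "complete_orthonormal_system e"
    and F: "F \<in> poly_functionals I"
  obtains N where
    "\<And>Y w n. w \<in> wiener_paths \<Longrightarrow> Y w \<in> cameron_martin \<Longrightarrow>
        tensor_term e Y F w summable_on {is. length is = n}"
    "\<And>Y w n. w \<in> wiener_paths \<Longrightarrow> n > N \<Longrightarrow> D_tensor e Y n F w = 0"
proof -
  from F obtain d h p where F_def: "F = (\<lambda>w. mpoly_eval p (\<lambda>i. I (h i) w))"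
    and h: "\<And>i. i < d \<Longrightarrow> h i \<in> cameron_martin" and p: "mpoly_vars_below d p"
    unfolding poly_functionals_def by blast
  let ?K = "Poly_Mapping.keys p" and ?g = "\<lambda>j :: nat \<times> nat. h (fst j)"
  have g: "?g j \<in> cameron_martin" if "m \<in> ?K" "j \<in> mpoly_occurrences m" for m j
    using p h that by (fastforce simp: mpoly_vars_below_def mpoly_occurrences_def)
  have e': "e i \<in> cameron_martin" for i
    using e by (simp add: complete_orthonormal_system_def)
  have tensor: "tensor_term e Y F w is = (\<Sum>m\<in>?K. Poly_Mapping.lookup p m *
      ((\<Prod>i\<leftarrow>is. cm_inner (Y w) (e i)) * monomial_deriv I e ?g is (mpoly_occurrences m) w))"
    if w: "w \<in> wiener_paths" for Y w "is"
  proof -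
    have "foldr (\<lambda>i. dir_deriv (e i)) is F w =
        (\<Sum>m\<in>?K. Poly_Mapping.lookup p m * monomial_deriv I e ?g is (mpoly_occurrences m) w)"
      by (rule foldr_dir_deriv_poly[OF I e'])
        (use g w in \<open>auto simp: F_def mpoly_eval_eq_sum_monomials finite_mpoly_occurrences\<close>)
    then show ?thesis
      by (simp add: tensor_term_def sum_distrib_left mult_ac)
  qed
  show ?thesis
  \<comment> \<open>The sum of the degrees of all monomials bounds each of them and is 0 for the
    zero polynomial, where a maximum would range over the empty set.\<close>
  proof (rule that[of "\<Sum>m\<in>?K. card (mpoly_occurrences m)"])
    fix Y w n assume w: "w \<in> wiener_paths" and Y: "Y w \<in> cameron_martin"
    have "(\<lambda>is. \<Sum>m\<in>?K. Poly_Mapping.lookup p m * ((\<Prod>i\<leftarrow>is. cm_inner (Y w) (e i)) *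
        monomial_deriv I e ?g is (mpoly_occurrences m) w)) summable_on {is. length is = n}"
      using g by (intro summable_on_sum summable_on_cmult_right monomial_deriv_summable e Y) auto
    then show "tensor_term e Y F w summable_on {is. length is = n}"
      by (simp add: tensor[OF w] cong: summable_on_cong)
  next
    fix Y w n assume w: "w \<in> wiener_paths" and n: "(\<Sum>m\<in>?K. card (mpoly_occurrences m)) < n"
    have "monomial_deriv I e ?g is (mpoly_occurrences m) w = 0" if "m \<in> ?K" "length is = n" for m "is"
      using n that member_le_sum[of m ?K "\<lambda>m. card (mpoly_occurrences m)"]
      by (intro monomial_deriv_eq_0 finite_mpoly_occurrences) auto
    then show "D_tensor e Y n F w = 0"
      unfolding D_tensor_def by (intro infsum_0) (auto simp: tensor[OF w] intro!: sum.neutral)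
  qed
qed

section \<open>The series of the operators\<close>

lemma D_tensor_0: "D_tensor e Y 0 F w = F w"
  by (simp add: D_tensor_def tensor_term_def)

text \<open>Fixing \<open>w\<close> reduces the operator identity to one between numerical
  series.\<close>

lemma L_op_sums:
  assumes fin: "\<And>n. n > N \<Longrightarrow> D_tensor e (path_minus Z) n F w = 0"
  shows "(\<lambda>n. 1 / fact (Suc n) * L_op e Z X (Suc n) F w) sums
      (exp (X 1 w - 1 / 2 * cm_inner (Z w) (Z w)) * (F w - exp_D e (path_minus Z) F w))"
proof -
  define H where "H n = hermite_hat n (X 1 w) (cm_inner (Z w) (Z w)) / fact n" for n
  \<comment> \<open>The sum in \<open>L_op\<close> starts at \<open>k = 1\<close>; setting
    \<open>a 0 = 0\<close> makes it a full convolution, and the sum of all \<open>a k\<close> is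
    \<open>exp_D\<close> minus the identity.\<close>
  define a where "a k = (if k = 0 then 0 else D_tensor e (path_minus Z) k F w / fact k)" for k
  define E where "E = exp (X 1 w - 1 / 2 * cm_inner (Z w) (Z w))"
  have H: "H sums E"
    using hermite_hat_generating[of 1 "X 1 w" "cm_inner (Z w) (Z w)"]
    by (simp add: H_def[abs_def] E_def)
  have L: "1 / fact n * L_op e Z X n F w = - (\<Sum>k\<le>n. a k * H (n - k))" if "n \<noteq> 0" for n
  proof -
    have "(\<Sum>k\<le>n. a k * H (n - k)) = (\<Sum>k=1..n. a k * H (n - k))"
      by (rule sum.mono_neutral_right) (auto simp: a_def)
    also have "\<dots> = (\<Sum>k=1..n. 1 / fact n * (real (n choose k) *
        hermite_hat (n - k) (X 1 w) (cm_inner (Z w) (Z w)) * D_tensor e (path_minus Z) k F w))"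
      by (intro sum.cong refl) (auto simp: a_def H_def binomial_fact field_simps)
    finally show ?thesis
      using that by (simp add: L_op_def sum_distrib_left)
  qed
  have Ls: "(\<lambda>n. - (\<Sum>k\<le>n. a k * H (n - k))) sums (- (\<Sum>k\<le>N. a k) * E)"
  proof -
    \<comment> \<open>Since \<open>a\<close> vanishes beyond \<open>N\<close>, the convolution is a
      finite sum of copies of the series \<open>H\<close>, each scaled by \<open>a k\<close> and
      delayed by \<open>k\<close> places with zeros in front.\<close>
    have "(\<lambda>n. \<Sum>k\<le>N. if n < k then 0 else a k * H (n - k)) sums (\<Sum>k\<le>N. a k * E)"
    proof (rule sums_sum)
      fix k
      have "(\<lambda>n. a k * H n) sums (a k * E)"
        by (rule sums_mult[OF H])
      then have "(\<lambda>n. (\<lambda>n. if n < k then 0 else a k * H (n - k)) (n + k)) sums (a k * E)"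
        by simp
      then show "(\<lambda>n. if n < k then 0 else a k * H (n - k)) sums (a k * E)"
        by (subst (asm) sums_iff_shift) simp
    qed
    moreover have "(\<Sum>k\<le>N. if n < k then 0 else a k * H (n - k)) = (\<Sum>k\<le>n. a k * H (n - k))" for n
    proof -
      have "(\<Sum>k\<le>N. if n < k then 0 else a k * H (n - k)) = (\<Sum>k\<in>{..N} \<inter> {..n}. a k * H (n - k))"
        by (rule sum.mono_neutral_cong_right) auto
      also have "\<dots> = (\<Sum>k\<le>n. a k * H (n - k))"
        by (rule sum.mono_neutral_left) (auto simp: a_def fin)
      finally show ?thesis .
    qed
    ultimately show ?thesis
      by (auto simp: sum_distrib_right dest: sums_minus)
  qed
  have "exp_D e (path_minus Z) F w = (\<Sum>n\<le>N. 1 / fact n * D_tensor e (path_minus Z) n F w)"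
    unfolding exp_D_def by (rule suminf_finite) (auto simp: fin)
  also have "\<dots> = F w + (\<Sum>n\<in>{..N} - {0}. 1 / fact n * D_tensor e (path_minus Z) n F w)"
    by (subst sum.remove[of _ 0]) (auto simp: D_tensor_0)
  also have "(\<Sum>n\<in>{..N} - {0}. 1 / fact n * D_tensor e (path_minus Z) n F w) = (\<Sum>k\<le>N. a k)"
    by (rule sum.mono_neutral_cong_left) (auto simp: a_def)
  finally have "E * (F w - exp_D e (path_minus Z) F w) = - (\<Sum>k\<le>N. a k) * E"
    by (simp add: algebra_simps)
  \<comment> \<open>The convolution at index 0 is \<open>a 0 * H 0 = 0\<close>, so starting at 1
    leaves the sum unchanged. There \<open>L_op\<close> is the identity instead, which is why
    \<open>L\<close> excludes that index.\<close>
  moreover have "(\<lambda>n. - (\<Sum>k\<le>Suc n. a k * H (Suc n - k))) sums (- (\<Sum>k\<le>N. a k) * E)"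
    using Ls by (subst sums_Suc_iff) (simp add: a_def)
  moreover have "(\<lambda>n. 1 / fact (Suc n) * L_op e Z X (Suc n) F w) =
      (\<lambda>n. - (\<Sum>k\<le>Suc n. a k * H (Suc n - k)))"
    by (intro ext L) simp
  ultimately show ?thesis
    by (simp only: E_def)
qed

section \<open>The almost sure statement\<close>

text \<open>\<open>L_op\<close> sees the norm of \<open>Z w\<close> through \<open>deriv\<close>,
  the stochastic exponential sees it through \<open>Zdot\<close>; uniqueness of derivatives
  identifies the two integrands almost everywhere.\<close>

lemma cm_inner_self_eq_integral:
  assumes Z: "z \<in> cameron_martin"
    and d: "AE t in lborel. t \<in> {0..1} \<longrightarrow> (z has_real_derivative zd t) (at t)"
    and zd: "set_integrable lborel {0..1} (\<lambda>t. (zd t)\<^sup>2)"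
  shows "cm_inner z z = (LBINT t:{0..1}. (zd t)\<^sup>2)"
proof -
  have "(\<integral>t. deriv01 z t * deriv01 z t \<partial>lborel) =
      (\<integral>t. indicat_real {0..1} t *\<^sub>R (zd t)\<^sup>2 \<partial>lborel)"
  proof (rule integral_cong_AE)
    show "(\<lambda>t. deriv01 z t * deriv01 z t)
        \<in> borel_measurable lborel"
      using cameron_martinD(4)[OF Z] by (intro borel_measurable_times) auto
    show "(\<lambda>t. indicat_real {0..1} t *\<^sub>R (zd t)\<^sup>2) \<in> borel_measurable lborel"
      using zd by (auto simp: set_integrable_def)
    show "AE t in lborel. deriv01 z t * deriv01 z t =
        indicat_real {0..1} t *\<^sub>R (zd t)\<^sup>2"
      using d by eventually_elim (auto simp: deriv01_def indicator_def power2_eq_square DERIV_imp_deriv)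
  qed
  then show ?thesis
    by (simp add: cm_inner_eq_integral set_lebesgue_integral_def)
qed

lemma space_wiener_measure:
  assumes "wiener_measure \<gamma>"
  shows "space \<gamma> = wiener_paths"
proof -
  have "{U. uniform_open U} \<subseteq> Pow wiener_paths"
    by (auto simp: uniform_open_def)
  then have "space wiener_sigma = wiener_paths"
    unfolding wiener_sigma_def by (rule space_measure_of)
  then show ?thesis
    using assms sets_eq_imp_space_eq unfolding wiener_measure_def by metis
qed

text \<open>\<open>infsum\<close> and \<open>suminf\<close> have values even without convergence, so
  the identity comes with the summability that gives \<open>D_tensor\<close> and
  \<open>exp_D\<close> their meaning. It holds almost surely because \<open>Z w\<close> is a
  Cameron-Martin path only for almost every \<open>w\<close>.\<close>

theorem lemma3p4:
  fixes \<gamma> :: "wpath measure"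
    and I :: "wpath \<Rightarrow> wpath \<Rightarrow> real"
    and Z :: "wpath \<Rightarrow> wpath"
    and Zdot X :: "real \<Rightarrow> wpath \<Rightarrow> real"
    and e :: "nat \<Rightarrow> wpath"
    and F :: "wpath \<Rightarrow> real"
  assumes "wiener_measure \<gamma>"
    and "wiener_integral_family \<gamma> I"
    and "predictable_map \<gamma> Z Zdot"
    and "is_ito_integral \<gamma> Zdot X"
    and "wiener_martingale \<gamma> (stoch_exp Zdot X)"
    and "complete_orthonormal_system e"
    and "F \<in> poly_functionals I"
  shows "AE w in \<gamma>.
    (\<forall>n. tensor_term e (path_minus Z) F w summable_on {is. length is = n}) \<and>
    summable (\<lambda>n. 1 / fact n * D_tensor e (path_minus Z) n F w) \<and>
    (\<lambda>n. 1 / fact (Suc n) * L_op e Z X (Suc n) F w) sums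
      (exp (X 1 w - 1 / 2 * (LBINT t:{0..1}. (Zdot t w)\<^sup>2)) * (F w - exp_D e (path_minus Z) F w))"
proof -
  obtain N where N:
    "\<And>Y w n. w \<in> wiener_paths \<Longrightarrow> Y w \<in> cameron_martin \<Longrightarrow>
        tensor_term e Y F w summable_on {is. length is = n}"
    "\<And>Y w n. w \<in> wiener_paths \<Longrightarrow> n > N \<Longrightarrow> D_tensor e Y n F w = 0"
    using poly_functional_tensor[OF assms(2,6,7)] by blast
  have "AE w in \<gamma>. w \<in> wiener_paths"
    using AE_space[of \<gamma>] by (simp add: space_wiener_measure[OF assms(1)])
  moreover have "AE w in \<gamma>. Z w \<in> cameron_martin \<and>
        (AE t in lborel. t \<in> {0..1} \<longrightarrow> (Z w has_real_derivative Zdot t w) (at t)) \<and>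
        set_integrable lborel {0..1} (\<lambda>t. (Zdot t w)\<^sup>2)"
    using assms(3) by (simp add: predictable_map_def)
  ultimately show ?thesis
  proof eventually_elim
    case (elim w)
    then have w: "w \<in> wiener_paths" and Z: "Z w \<in> cameron_martin" by auto
    have "path_minus Z w \<in> cameron_martin"
      using cameron_martin_cmult[OF Z, of "-1"] by (simp add: path_minus_def)
    then have "tensor_term e (path_minus Z) F w summable_on {is. length is = n}" for n
      using N(1) w by blast
    moreover have "summable (\<lambda>n. 1 / fact n * D_tensor e (path_minus Z) n F w)"
      by (rule summable_finite[of "{..N}"]) (auto simp: N(2) w)
    moreover have "cm_inner (Z w) (Z w) = (LBINT t:{0..1}. (Zdot t w)\<^sup>2)"
      using elim by (intro cm_inner_self_eq_integral) auto
    ultimately show ?case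
      using L_op_sums[of N e Z F w X] N(2)[OF w] by auto
  qed
qed

end
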